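(* Let $A\in\mathbb{R}^{n\times n}$ be nonsingular, $u,v,b\in\mathbb{R}^n$, and suppose that all linear systems with $A$ are solved normwise backward stably with stability constant $c_s$. Assuming $\widehat\beta\neq0$, let $\widehat x$ be the solution of $(A+uv^T)x=b$ computed by the modified Sherman--Morrison algorithm (MSM) in floating point arithmetic with unit roundoff $\epsilon_M$, and let $\widehat p,\widehat\theta,\widehat\theta_1$ be the computed values of the correction vector $p$ and the scalars $\theta,\theta_1$ in that algorithm. Then there exist $\Delta A,\Delta G\in\mathbb{R}^{n\times n}$ and $\Delta u,\Delta v,\Delta b,\Delta g\in\mathbb{R}^n$ such that $$\big(A+\Delta A+(u+\Delta u)(v+\Delta v)^T\big)\widehat x=b+\Delta b+\Delta G\,\widehat p+\Delta g,$$ where \begin{align*} \|\Delta A\|&\le\big((1+c_s)\epsilon_M+\mathcal O(\epsilon_M^2)\big)\|A\|,\\ \|\Delta u\|&\le\big(2\epsilon_M+\mathcal O(\epsilon_M^2)\big)\|u\|,\\ \|\Delta v\|&\le\big((n+1)\epsilon_M+\mathcal O(\epsilon_M^2)\big)\|v\|,\\ \|\Delta b\|&\le\epsilon_M\|b\|,\\ \|\Delta G\|&\le\big((6+2c_s)\epsilon_M+\mathcal O(\epsilon_M^2)\big)\|A\|+\big((2n+4)\epsilon_M+\mathcal O(\epsilon_M^2)\big)\|u\|\,\|v\|,\\ \|\Delta g\|&\le c_s\epsilon_M\big(\|b\|+\|u\|(|\widehat\theta|+|\widehat\theta_1|)\big)+\mathcal O(\epsilon_M^2). \end{align*}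
   Context: Norms: $\|\cdot\|$ is the Euclidean vector norm and the induced matrix 2-norm. Algorithm MSM (for $(A+uv^T)x=b$): (1) solve $Ay=b$ for $y$; (2) solve $Az=u$ for $z$; (3) compute $\alpha=v^Ty$, $\beta=1+v^Tz$, $\theta=\alpha/\beta$; (4) compute $d=b-u\theta$; (5) solve $Aw=d$ for $w$; (6) compute $\theta_1=(v^Tw-\theta)/\beta$; (7) compute $p=z\theta_1$; (8) output $x=w-p$. Hats denote the quantities actually computed in floating point arithmetic. The matrix $A+uv^T$ is nonsingular (equivalently, the exact $\beta$ is nonzero). Floating point model: $\epsilon_M$ is the unit roundoff, $n\epsilon_M<1$, $\gamma_n=n\epsilon_M/(1-n\epsilon_M)$. Every scalar operation satisfies $\mathrm{fl}(a\circ b)=(a\circ b)(1+\delta)$, $|\delta|\le\epsilon_M$, $\circ\in\{+,-,\times,/\}$ (vector operations being performed entrywise). A computed inner product satisfies $\mathrm{fl}(v^Tw)=v^T(I+D)w$ with $D$ diagonal and $|D|\le\gamma_n I$ entrywise. Normwise backward stable solve with constant $c_s$ (a fixed constant independent of $\epsilon_M$): for a right-hand side $g$ (in step (5) the computed vector $\widehat d$), the computed solution $\widehat s$ of $As=g$ satisfies $(A+\delta A)\widehat s=g+\delta g$ for some $\delta A,\delta g$ (which may differ from solve to solve) with $\|\delta A\|\le c_s\epsilon_M\|A\|$ and $\|\delta g\|\le c_s\epsilon_M\|g\|$. $\mathcal O(\epsilon_M^2)$ denotes a quantity bounded in absolute value by $C\epsilon_M^2$ for all sufficiently small $\epsilon_M>0$,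 where $C$ and the smallness threshold may depend on $n,c_s,A,u,v,b$ but not on $\epsilon_M$ or on the particular rounding errors committed. *)

theory Defs
  imports "HOL-Analysis.Analysis"
begin

text \<open>
  The library norm on \<^typ>\<open>real^'n^'n\<close> is the Frobenius norm; the matrix 2-norm is the
  operator norm of the associated linear map.
\<close>

definition mnorm2 :: "real^'n^'n \<Rightarrow> real" where
  "mnorm2 M = onorm ((*v) M)"

definition outer :: "real^'n \<Rightarrow> real^'n \<Rightarrow> real^'n^'n" where
  "outer u v = (\<chi> i j. u $ i * v $ j)"

text \<open>
  Rounding is nondeterministic: each predicate below says which computed values are
  admissible for unit roundoff \<open>\<epsilon>\<close>, the computed value being the last argument.
\<close>

definition fl_scalar :: "real \<Rightarrow> real \<Rightarrow> real \<Rightarrow> bool" where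
  "fl_scalar \<epsilon> r c \<longleftrightarrow> (\<exists>\<delta>. \<bar>\<delta>\<bar> \<le> \<epsilon> \<and> c = r * (1 + \<delta>))"

definition fl_vec :: "real \<Rightarrow> real^'n \<Rightarrow> real^'n \<Rightarrow> bool" where
  "fl_vec \<epsilon> r c \<longleftrightarrow> (\<forall>i. fl_scalar \<epsilon> (r $ i) (c $ i))"

definition gam :: "nat \<Rightarrow> real \<Rightarrow> real" where
  "gam n \<epsilon> = real n * \<epsilon> / (1 - real n * \<epsilon>)"

text \<open>The bound \<open>|D| \<le> \<gamma>\<^sub>n I\<close>, read entrywise, also forces \<open>D\<close> to be diagonal.\<close>

definition fl_inner :: "real \<Rightarrow> real^'n \<Rightarrow> real^'n \<Rightarrow> real \<Rightarrow> bool" where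
  "fl_inner \<epsilon> v w c \<longleftrightarrow>
     (\<exists>D :: real^'n^'n.
        (\<forall>i j. \<bar>D $ i $ j\<bar> \<le> gam CARD('n) \<epsilon> * (mat 1 :: real^'n^'n) $ i $ j) \<and>
        c = v \<bullet> ((mat 1 + D) *v w))"

definition backward_stable_solve ::
    "real \<Rightarrow> real \<Rightarrow> real^'n^'n \<Rightarrow> real^'n \<Rightarrow> real^'n \<Rightarrow> bool" where
  "backward_stable_solve c\<^sub>s \<epsilon> A g s \<longleftrightarrow>
     (\<exists>\<delta>A \<delta>g. (A + \<delta>A) *v s = g + \<delta>g \<and>
        mnorm2 \<delta>A \<le> c\<^sub>s * \<epsilon> * mnorm2 A \<and> norm \<delta>g \<le> c\<^sub>s * \<epsilon> * norm g)"

text \<open>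
  All components are computed quantities. The fields \<open>vz_hat\<close>, \<open>ut_hat\<close>, \<open>vw_hat\<close> and \<open>num_hat\<close> are the
  rounded intermediate results \<open>v\<^sup>T z\<close>, \<open>u \<theta>\<close>, \<open>v\<^sup>T w\<close> and \<open>v\<^sup>T w - \<theta>\<close>.
\<close>

record 'n msm_values =
  y_hat :: "real^'n"
  z_hat :: "real^'n"
  alpha_hat :: real
  vz_hat :: real
  beta_hat :: real
  theta_hat :: real
  ut_hat :: "real^'n"
  d_hat :: "real^'n"
  w_hat :: "real^'n"
  vw_hat :: real
  num_hat :: real
  theta1_hat :: real
  p_hat :: "real^'n"
  x_hat :: "real^'n"

definition msm_run ::
    "real \<Rightarrow> real \<Rightarrow> real^'n^'n \<Rightarrow> real^'n \<Rightarrow> real^'n \<Rightarrow> real^'n \<Rightarrow> 'n msm_values \<Rightarrow> bool" where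
  "msm_run c\<^sub>s \<epsilon> A u v b R \<longleftrightarrow>
     backward_stable_solve c\<^sub>s \<epsilon> A b (y_hat R) \<and>
     backward_stable_solve c\<^sub>s \<epsilon> A u (z_hat R) \<and>
     fl_inner \<epsilon> v (y_hat R) (alpha_hat R) \<and>
     fl_inner \<epsilon> v (z_hat R) (vz_hat R) \<and>
     fl_scalar \<epsilon> (1 + vz_hat R) (beta_hat R) \<and>
     fl_scalar \<epsilon> (alpha_hat R / beta_hat R) (theta_hat R) \<and>
     fl_vec \<epsilon> (theta_hat R *\<^sub>R u) (ut_hat R) \<and>
     fl_vec \<epsilon> (b - ut_hat R) (d_hat R) \<and>
     backward_stable_solve c\<^sub>s \<epsilon> A (d_hat R) (w_hat R) \<and>
     fl_inner \<epsilon> v (w_hat R) (vw_hat R) \<and>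
     fl_scalar \<epsilon> (vw_hat R - theta_hat R) (num_hat R) \<and>
     fl_scalar \<epsilon> (num_hat R / beta_hat R) (theta1_hat R) \<and>
     fl_vec \<epsilon> (theta1_hat R *\<^sub>R z_hat R) (p_hat R) \<and>
     fl_vec \<epsilon> (w_hat R - p_hat R) (x_hat R)"

end

theory Submission
  imports Defs
begin

text \<open>
  All roundings outside the solves are diagonal matrices close to the identity. The computed
  \<open>\<beta>\<close> is the same number in \<open>\<theta>\<close> and \<open>\<theta>\<^sub>1\<close>, so \<open>\<theta>\<^sub>1 \<beta>\<close> is a perturbed \<open>v\<^sup>T w - \<theta>\<close> and the backward
  error of \<open>\<theta>\<close> itself (hence the solve for \<open>y\<close>) matters only through the size of \<open>\<theta>\<close>. Solving for \<open>\<theta>\<close> and writing \<open>w\<close> and \<open>\<theta>\<^sub>1 z\<close> as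
  diagonal perturbations in terms of \<open>x\<close> and \<open>p\<close> turns the two perturbed systems for \<open>w\<close> and
  \<open>z\<close> into an exact linear identity between \<open>x\<close> and \<open>p\<close>, whose coefficients are the backward
  errors.
\<close>

section \<open>The matrix 2-norm\<close>

lemma norm_matrix_vector_mult_le: "norm (M *v x) \<le> mnorm2 M * norm x"
  unfolding mnorm2_def by (rule onorm) (rule matrix_vector_mul_bounded_linear)

lemma mnorm2_le: "(\<And>x. norm (M *v x) \<le> c * norm x) \<Longrightarrow> mnorm2 M \<le> c"
  unfolding mnorm2_def by (rule onorm_le)

lemma mnorm2_nonneg: "0 \<le> mnorm2 M"
  unfolding mnorm2_def by (rule onorm_pos_le) (rule matrix_vector_mul_bounded_linear)

lemma mnorm2_add_le: "mnorm2 (M + N) \<le> mnorm2 M + mnorm2 N"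
proof (rule mnorm2_le)
  fix x
  have "norm ((M + N) *v x) \<le> norm (M *v x) + norm (N *v x)"
    by (simp add: matrix_vector_mult_add_rdistrib norm_triangle_ineq)
  also have "\<dots> \<le> mnorm2 M * norm x + mnorm2 N * norm x"
    by (intro add_mono norm_matrix_vector_mult_le)
  finally show "norm ((M + N) *v x) \<le> (mnorm2 M + mnorm2 N) * norm x"
    by (simp add: distrib_right)
qed

lemma mnorm2_diff_le: "mnorm2 (M - N) \<le> mnorm2 M + mnorm2 N"
proof (rule mnorm2_le)
  fix x
  have "norm ((M - N) *v x) \<le> norm (M *v x) + norm (N *v x)"
    by (simp add: matrix_vector_mult_diff_rdistrib norm_triangle_ineq4)
  also have "\<dots> \<le> mnorm2 M * norm x + mnorm2 N * norm x"
    by (intro add_mono norm_matrix_vector_mult_le)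
  finally show "norm ((M - N) *v x) \<le> (mnorm2 M + mnorm2 N) * norm x"
    by (simp add: distrib_right)
qed

lemma mnorm2_mult_le: "mnorm2 (M ** N) \<le> mnorm2 M * mnorm2 N"
proof (rule mnorm2_le)
  fix x
  have "norm ((M ** N) *v x) \<le> mnorm2 M * norm (N *v x)"
    by (simp add: matrix_vector_mul_assoc[symmetric] norm_matrix_vector_mult_le)
  also have "\<dots> \<le> mnorm2 M * (mnorm2 N * norm x)"
    by (intro mult_left_mono norm_matrix_vector_mult_le mnorm2_nonneg)
  finally show "norm ((M ** N) *v x) \<le> mnorm2 M * mnorm2 N * norm x"
    by (simp add: mult.assoc)
qed

lemma mnorm2_pos:
  assumes "invertible M"
  shows "0 < mnorm2 M"
proof (rule ccontr)
  assume "\<not> 0 < mnorm2 M"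
  then have "mnorm2 M = 0" using mnorm2_nonneg[of M] by simp
  then have zero: "M *v x = 0" for x
    using norm_matrix_vector_mult_le[of M x] by simp
  \<comment> \<open>A unit vector at an arbitrary index is killed by \<open>M\<close>, so
    injectivity would make it zero.\<close>
  have "axis undefined 1 = (0 :: real^'a)"
    by (rule injD[OF inj_matrix_vector_mult[OF assms]]) (simp add: zero)
  then show False by simp
qed

lemma
  fixes M :: "real^'n^'n"
  assumes "invertible M"
  shows matrix_inv_right: "M ** matrix_inv M = mat 1"
    and matrix_inv_left: "matrix_inv M ** M = mat 1"
  using someI_ex[OF assms[unfolded invertible_def]] by (simp_all add: matrix_inv_def)

lemma outer_mult_vec: "outer a c *v x = (c \<bullet> x) *\<^sub>R a"
  by (simp add: vec_eq_iff outer_def matrix_vector_mult_def inner_vec_def sum_distrib_left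
      sum_distrib_right mult_ac)

lemma mnorm2_outer_le: "mnorm2 (outer a c) \<le> norm a * norm c"
proof (rule mnorm2_le)
  fix x
  have "\<bar>c \<bullet> x\<bar> * norm a \<le> (norm c * norm x) * norm a"
    by (intro mult_right_mono Cauchy_Schwarz_ineq2) simp
  then show "norm (outer a c *v x) \<le> norm a * norm c * norm x"
    by (simp add: outer_mult_vec mult_ac)
qed

section \<open>Diagonal matrices\<close>

text \<open>Indexing by a function turns a componentwise family of rounding factors directly into a
  matrix, so that successive roundings compose by pointwise multiplication of functions.\<close>

definition diag :: "('n \<Rightarrow> real) \<Rightarrow> real^'n^'n" where
  "diag f = (\<chi> i j. if i = j then f i else 0)"

lemma diag_mult_vec_nth [simp]: "(diag f *v x) $ i = f i * x $ i"
proof -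
  have "(\<Sum>j\<in>UNIV. (if i = j then f i else 0) * x $ j)
      = (\<Sum>j\<in>UNIV. if i = j then f i * x $ j else 0)"
    by (intro sum.cong) auto
  then show ?thesis by (simp add: diag_def matrix_vector_mult_def)
qed

lemma diag_minus_mat_1: "diag f - mat 1 = diag (\<lambda>i. f i - 1)"
  by (simp add: vec_eq_iff diag_def mat_def)

text \<open>Diagonal matrices are symmetric. This moves the rounding of an inner product from the
  second argument onto \<open>v\<close>, which is how the perturbation of \<open>v\<close>
  arises.\<close>

lemma inner_diag: "a \<bullet> (diag f *v x) = (diag f *v a) \<bullet> x"
  by (simp add: inner_vec_def mult_ac)

lemma diag_mult_diag_vec: "diag f *v (diag g *v x) = diag (\<lambda>i. f i * g i) *v x"
  by (simp add: vec_eq_iff)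

lemma norm_diag_mult_vec_le:
  assumes "\<And>i. \<bar>f i\<bar> \<le> c"
  shows "norm (diag f *v x) \<le> c * norm x"
proof -
  \<comment> \<open>The index type is nonempty, so the bound at any single index already gives the
    sign of \<open>c\<close>.\<close>
  have c: "0 \<le> c" using assms[of undefined] by linarith
  have "norm (diag f *v x) \<le> norm (c *\<^sub>R x)"
    by (rule norm_le_componentwise_cart) (use assms c in \<open>simp add: abs_mult mult_right_mono\<close>)
  then show ?thesis using c by simp
qed

lemma mnorm2_diag_le: "(\<And>i. \<bar>f i\<bar> \<le> c) \<Longrightarrow> mnorm2 (diag f) \<le> c"
  by (intro mnorm2_le norm_diag_mult_vec_le)

lemma norm_diag_minus_le:
  assumes "\<And>i. \<bar>f i - 1\<bar> \<le> c"
  shows "norm (diag f *v x - x) \<le> c * norm x"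
proof -
  have "diag f *v x - x = diag (\<lambda>i. f i - 1) *v x"
    by (simp add: vec_eq_iff algebra_simps)
  then show ?thesis using norm_diag_mult_vec_le[of "\<lambda>i. f i - 1" c x] assms by simp
qed

lemma norm_diag_near_le:
  assumes "\<And>i. \<bar>f i - 1\<bar> \<le> c"
  shows "norm (diag f *v x) \<le> (1 + c) * norm x"
proof (rule norm_diag_mult_vec_le)
  show "\<bar>f i\<bar> \<le> 1 + c" for i using assms[of i] by linarith
qed

lemma matrix_diff_ldistrib: "A ** (B - C) = A ** B - A ** (C :: real^'n^'n)"
  by (simp add: matrix_eq matrix_vector_mul_assoc[symmetric] matrix_vector_mult_diff_distrib
      matrix_vector_mult_diff_rdistrib)

lemma matrix_diff_rdistrib: "(A - B) ** C = A ** C - B ** (C :: real^'n^'n)"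
  by (simp add: matrix_eq matrix_vector_mul_assoc[symmetric] matrix_vector_mult_diff_rdistrib)

text \<open>With F for \<open>diag f\<close>, write X F - A = X (F - I) + (X - A) and bound the norm
  of X by (1 + s) times that of A; the resulting factor is (1 + s)(1 + r) - 1. Factors on the
  solution of a system multiply its matrix from the right, factors on its right-hand side from the
  left.\<close>

lemma mnorm2_mult_diag_minus_le:
  assumes X: "mnorm2 (X - A) \<le> s * mnorm2 A" and s: "0 \<le> s"
    and f: "\<And>i. \<bar>f i - 1\<bar> \<le> r"
  shows "mnorm2 (X ** diag f - A) \<le> (s + r + s * r) * mnorm2 A"
    and "mnorm2 (diag f ** X - A) \<le> (s + r + s * r) * mnorm2 A"
proof -
  have r: "0 \<le> r" using f[of undefined] by linarith
  have "mnorm2 X = mnorm2 (A + (X - A))" by simp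
  also have "\<dots> \<le> mnorm2 A + s * mnorm2 A"
    using mnorm2_add_le[of A "X - A"] X by linarith
  finally have X': "mnorm2 X \<le> (1 + s) * mnorm2 A" by (simp add: algebra_simps)
  have F: "mnorm2 (diag f - mat 1) \<le> r"
    unfolding diag_minus_mat_1 by (intro mnorm2_diag_le f)
  have XF: "mnorm2 X * mnorm2 (diag f - mat 1) \<le> (1 + s) * mnorm2 A * r"
    by (intro mult_mono X' F) (use s mnorm2_nonneg[of A] mnorm2_nonneg[of "diag f - mat 1"] in auto)
  have "X ** diag f - A = X ** (diag f - mat 1) + (X - A)"
    by (simp add: matrix_diff_ldistrib)
  then show "mnorm2 (X ** diag f - A) \<le> (s + r + s * r) * mnorm2 A"
    using mnorm2_add_le[of "X ** (diag f - mat 1)" "X - A"]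
      mnorm2_mult_le[of X "diag f - mat 1"] X XF by (simp add: algebra_simps)
  have "diag f ** X - A = (diag f - mat 1) ** X + (X - A)"
    by (simp add: matrix_diff_rdistrib)
  then show "mnorm2 (diag f ** X - A) \<le> (s + r + s * r) * mnorm2 A"
    using mnorm2_add_le[of "(diag f - mat 1) ** X" "X - A"]
      mnorm2_mult_le[of "diag f - mat 1" X] X XF by (simp add: algebra_simps)
qed

section \<open>First-order error bounds\<close>

text \<open>Explicit form of a first-order bound with an O(\<epsilon>^2) remainder: \<open>k\<close>
  is tracked exactly, while \<open>K\<close> only has to be independent of \<epsilon> and of the
  rounding errors.\<close>

definition ub :: "real \<Rightarrow> real \<Rightarrow> real \<Rightarrow> real" where
  "ub k K \<epsilon> = k * \<epsilon> + K * \<epsilon>\<^sup>2"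

text \<open>Second-order coefficient for the product of two factors near 1. The cross term
  contributes (k + K)(l + L), because each error is at most linear in \<epsilon> once \<epsilon> is
  at most 1.\<close>

definition ub_const :: "real \<Rightarrow> real \<Rightarrow> real \<Rightarrow> real \<Rightarrow> real" where
  "ub_const k K l L = K + L + (k + K) * (l + L)"

lemma ub_const_nonneg:
  "\<lbrakk>0 \<le> k; 0 \<le> K; 0 \<le> l; 0 \<le> L\<rbrakk> \<Longrightarrow> 0 \<le> ub_const k K l L"
  by (simp add: ub_const_def)

lemma ub_nonneg: "\<lbrakk>0 \<le> k; 0 \<le> K; 0 \<le> \<epsilon>\<rbrakk> \<Longrightarrow> 0 \<le> ub k K \<epsilon>"
  by (simp add: ub_def)

lemma ub_mono: "K \<le> C \<Longrightarrow> ub k K \<epsilon> \<le> ub k C \<epsilon>"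
  by (simp add: ub_def mult_right_mono)

lemma ub_le_linear:
  assumes "0 \<le> \<epsilon>" "\<epsilon> \<le> 1" "0 \<le> K"
  shows "ub k K \<epsilon> \<le> (k + K) * \<epsilon>"
proof -
  have "K * (\<epsilon> * \<epsilon>) \<le> K * (\<epsilon> * 1)"
    using assms by (intro mult_left_mono) auto
  then show ?thesis by (simp add: ub_def power2_eq_square algebra_simps)
qed

lemma ub_mult_le:
  assumes "0 \<le> \<epsilon>" "\<epsilon> \<le> 1" "0 \<le> k" "0 \<le> K" "0 \<le> l" "0 \<le> L"
  shows "ub k K \<epsilon> * ub l L \<epsilon> \<le> (k + K) * (l + L) * \<epsilon>\<^sup>2"
proof -
  have "ub k K \<epsilon> * ub l L \<epsilon> \<le> ((k + K) * \<epsilon>) * ((l + L) * \<epsilon>)"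
    using assms by (intro mult_mono ub_le_linear ub_nonneg) auto
  then show ?thesis by (simp add: power2_eq_square mult_ac)
qed

lemma ub_combine:
  assumes "0 \<le> \<epsilon>" "\<epsilon> \<le> 1" "0 \<le> k" "0 \<le> K" "0 \<le> l" "0 \<le> L"
  shows "ub k K \<epsilon> + ub l L \<epsilon> + ub k K \<epsilon> * ub l L \<epsilon> \<le> ub (k + l) (ub_const k K l L) \<epsilon>"
  using ub_mult_le[OF assms] by (simp add: ub_def ub_const_def algebra_simps)

text \<open>From st - 1 = (s - 1) + (t - 1) + (s - 1)(t - 1): the first-order coefficients add, and
  everything else goes into the quadratic term. All the leading constants of the theorem are counted
  through this rule.\<close>

lemma near_one_mult:
  assumes "\<bar>s - 1\<bar> \<le> ub k K \<epsilon>" "\<bar>t - 1\<bar> \<le> ub l L \<epsilon>"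
    and "0 \<le> \<epsilon>" "\<epsilon> \<le> 1" "0 \<le> k" "0 \<le> K" "0 \<le> l" "0 \<le> L"
  shows "\<bar>s * t - 1\<bar> \<le> ub (k + l) (ub_const k K l L) \<epsilon>"
proof -
  have "s * t - 1 = (s - 1) + (t - 1) + (s - 1) * (t - 1)" by (simp add: algebra_simps)
  then have "\<bar>s * t - 1\<bar> \<le> \<bar>s - 1\<bar> + \<bar>t - 1\<bar> + \<bar>s - 1\<bar> * \<bar>t - 1\<bar>"
    using abs_triangle_ineq[of "(s - 1) + (t - 1)" "(s - 1) * (t - 1)"]
      abs_triangle_ineq[of "s - 1" "t - 1"] unfolding abs_mult by linarith
  also have "\<dots> \<le> ub k K \<epsilon> + ub l L \<epsilon> + ub k K \<epsilon> * ub l L \<epsilon>"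
    using assms by (intro add_mono mult_mono ub_nonneg) auto
  also have "\<dots> \<le> ub (k + l) (ub_const k K l L) \<epsilon>"
    using assms by (intro ub_combine)
  finally show ?thesis .
qed

text \<open>Here 1/t - 1 = (1 - t)/t, and 1/t is at most 1 + 2\<epsilon>. Inverses occur when a
  computed result is solved for the exact operand.\<close>

lemma near_one_inverse:
  fixes t :: real
  assumes t: "\<bar>t - 1\<bar> \<le> \<epsilon>" and e: "\<epsilon> \<le> 1/2"
  shows "\<bar>inverse t - 1\<bar> \<le> ub 1 2 \<epsilon>" and "t \<noteq> 0"
proof -
  have t2: "1/2 \<le> t" using assms by linarith
  then show t0: "t \<noteq> 0" by auto
  have "inverse t - 1 = (1 - t) * inverse t" using t0 by (simp add: field_simps)
  then have eq: "\<bar>inverse t - 1\<bar> = \<bar>t - 1\<bar> * inverse t"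
    using t2 by (simp add: abs_mult abs_minus_commute)
  \<comment> \<open>The product expands to 1 + \<epsilon>(1 - 2\<epsilon>).\<close>
  have "1 \<le> (1 + 2 * \<epsilon>) * (1 - \<epsilon>)"
    using mult_nonneg_nonneg[of \<epsilon> "1 - 2 * \<epsilon>"] assms by (simp add: algebra_simps)
  also have "\<dots> \<le> (1 + 2 * \<epsilon>) * t" using assms by (intro mult_left_mono) auto
  finally have "inverse t \<le> 1 + 2 * \<epsilon>" using t2 by (simp add: field_simps)
  then have "\<bar>t - 1\<bar> * inverse t \<le> \<epsilon> * (1 + 2 * \<epsilon>)"
    using assms t2 by (intro mult_mono) auto
  then show "\<bar>inverse t - 1\<bar> \<le> ub 1 2 \<epsilon>"
    by (simp add: eq ub_def power2_eq_square algebra_simps)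
qed

text \<open>With s = n\<epsilon>, the claim s/(1 - s) \<le> s + 2s^2 reduces to s^2(1 - 2s) \<ge>
  0.\<close>

lemma gam_le_ub:
  assumes "0 \<le> \<epsilon>" "real n * \<epsilon> \<le> 1/2"
  shows "gam n \<epsilon> \<le> ub (real n) (2 * (real n)\<^sup>2) \<epsilon>"
proof -
  define s where "s = real n * \<epsilon>"
  have s: "0 \<le> s" "s \<le> 1/2" using assms by (auto simp: s_def)
  have "0 \<le> s * s * (1 - 2 * s)" using s by (intro mult_nonneg_nonneg) auto
  then have "s \<le> (s + 2 * s\<^sup>2) * (1 - s)" by (simp add: power2_eq_square algebra_simps)
  then have "s / (1 - s) \<le> s + 2 * s\<^sup>2" using s by (simp add: pos_divide_le_eq)
  then show ?thesis by (simp add: gam_def ub_def s_def power_mult_distrib mult_ac)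
qed

section \<open>Floating point operations\<close>

lemma fl_scalar_factor:
  assumes "fl_scalar \<epsilon> r c"
  obtains t where "\<bar>t - 1\<bar> \<le> \<epsilon>" "c = r * t"
  using assms unfolding fl_scalar_def by (metis add_diff_cancel_left')

text \<open>A crude factor 2 is enough here: it serves only to bound the computed scalars uniformly,
  not to obtain leading constants.\<close>

lemma fl_scalar_abs_le:
  assumes "fl_scalar \<epsilon> r c" "\<epsilon> \<le> 1"
  shows "\<bar>c\<bar> \<le> 2 * \<bar>r\<bar>"
proof -
  obtain t where t: "\<bar>t - 1\<bar> \<le> \<epsilon>" "c = r * t" using assms(1) by (rule fl_scalar_factor)
  then have "\<bar>r\<bar> * \<bar>t\<bar> \<le> \<bar>r\<bar> * 2" using assms(2) by (intro mult_left_mono) auto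
  then show ?thesis using t by (simp add: abs_mult)
qed

lemma fl_vec_diag:
  assumes "fl_vec \<epsilon> r c"
  obtains f where "\<And>i. \<bar>f i - 1\<bar> \<le> \<epsilon>" "c = diag f *v r"
proof -
  have "\<forall>i. \<exists>t. \<bar>t - 1\<bar> \<le> \<epsilon> \<and> c $ i = t * r $ i"
    using assms unfolding fl_vec_def by (metis fl_scalar_factor mult.commute)
  then obtain f where "\<And>i. \<bar>f i - 1\<bar> \<le> \<epsilon> \<and> c $ i = f i * r $ i" by metis
  then show ?thesis using that[of f] by (simp add: vec_eq_iff)
qed

lemma fl_inner_diag:
  fixes v w :: "real^'n"
  assumes "fl_inner \<epsilon> v w c"
  obtains f where "\<And>i. \<bar>f i - 1\<bar> \<le> gam CARD('n) \<epsilon>" "c = v \<bullet> (diag f *v w)"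
proof -
  obtain D :: "real^'n^'n" where
    D: "\<And>i j. \<bar>D $ i $ j\<bar> \<le> gam CARD('n) \<epsilon> * (mat 1 :: real^'n^'n) $ i $ j"
    and c: "c = v \<bullet> ((mat 1 + D) *v w)"
    using assms unfolding fl_inner_def by blast
  define f where "f i = 1 + D $ i $ i" for i
  \<comment> \<open>Off the diagonal the entrywise bound is zero.\<close>
  have "D $ i $ j = 0" if "i \<noteq> j" for i j
    using D[of i j] that by (simp add: mat_def)
  then have "mat 1 + D = diag f"
    by (simp add: vec_eq_iff diag_def f_def mat_def)
  moreover have "\<bar>f i - 1\<bar> \<le> gam CARD('n) \<epsilon>" for i
    using D[of i i] by (simp add: f_def mat_def)
  ultimately show ?thesis using that[of f] c by simp
qed

lemma gam_le_one: "real n * \<epsilon> \<le> 1/2 \<Longrightarrow> gam n \<epsilon> \<le> 1"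
  by (simp add: gam_def pos_divide_le_eq mult_ac)

lemma fl_inner_abs_le:
  fixes v w :: "real^'n"
  assumes "fl_inner \<epsilon> v w c" "real CARD('n) * \<epsilon> \<le> 1/2"
  shows "\<bar>c\<bar> \<le> 2 * (norm v * norm w)"
proof -
  obtain f where f: "\<And>i. \<bar>f i - 1\<bar> \<le> gam CARD('n) \<epsilon>" and c: "c = v \<bullet> (diag f *v w)"
    using fl_inner_diag[OF assms(1)] by blast
  have "\<bar>f i - 1\<bar> \<le> 1" for i using f[of i] gam_le_one[OF assms(2)] by linarith
  then have "norm (diag f *v w) \<le> 2 * norm w" using norm_diag_near_le[of f 1 w] by simp
  then have "norm v * norm (diag f *v w) \<le> norm v * (2 * norm w)" by (intro mult_left_mono) auto
  then show ?thesis using Cauchy_Schwarz_ineq2[of v "diag f *v w"] by (simp add: c)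
qed

lemma fl_vec_norm_le:
  assumes "fl_vec \<epsilon> r c" "\<epsilon> \<le> 1"
  shows "norm c \<le> 2 * norm r"
proof -
  obtain f where f: "\<And>i. \<bar>f i - 1\<bar> \<le> \<epsilon>" and c: "c = diag f *v r"
    using fl_vec_diag[OF assms(1)] by blast
  have "\<bar>f i - 1\<bar> \<le> 1" for i using f[of i] assms(2) by linarith
  then show ?thesis using norm_diag_near_le[of f 1 r] by (simp add: c)
qed

section \<open>Normwise backward stable solves\<close>

text \<open>A norm cannot be negative, and \<epsilon> times the norm of \<open>A\<close> is
  positive. Hence a negative stability constant admits no solve at all.\<close>

lemma backward_stable_solve_const_nonneg:
  fixes A :: "real^'n^'n"
  assumes "backward_stable_solve c \<epsilon> A g s" "invertible A" "0 < \<epsilon>"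
  shows "0 \<le> c"
proof -
  obtain M :: "real^'n^'n" where "mnorm2 M \<le> c * \<epsilon> * mnorm2 A"
    using assms(1) unfolding backward_stable_solve_def by blast
  then have "0 \<le> c * (\<epsilon> * mnorm2 A)" using mnorm2_nonneg[of M] by (simp add: mult.assoc)
  moreover have "0 < \<epsilon> * mnorm2 A" using assms(3) mnorm2_pos[OF assms(2)] by simp
  ultimately show ?thesis by (metis not_less zero_le_mult_iff)
qed

text \<open>Moving the backward errors to the right gives s - A^{-1} g = A^{-1} (h - M s). The first
  bound measures the distance to the exact solution, the second makes the size of \<open>s\<close>
  independent of the rounding errors.\<close>

lemma backward_stable_solve_bounds:
  fixes A :: "real^'n^'n"
  defines "N \<equiv> mnorm2 (matrix_inv A)"
  assumes solve: "backward_stable_solve c \<epsilon> A g s" and A: "invertible A"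
    and c: "0 \<le> c" and e: "0 \<le> \<epsilon>" "\<epsilon> \<le> 1"
    and small: "c * \<epsilon> * (N * mnorm2 A) \<le> 1/2"
  shows "norm (s - matrix_inv A *v g) \<le> N * (c * (norm g + mnorm2 A * norm s)) * \<epsilon>"
    and "norm s \<le> 2 * N * (1 + c) * norm g"
proof -
  obtain M h where eq: "(A + M) *v s = g + h"
    and M: "mnorm2 M \<le> c * \<epsilon> * mnorm2 A" and h: "norm h \<le> c * \<epsilon> * norm g"
    using solve unfolding backward_stable_solve_def by blast
  have N: "0 \<le> N" by (simp add: N_def mnorm2_nonneg)
  have "A *v s = g + (h - M *v s)"
    using eq by (simp add: algebra_simps)
  then have "matrix_inv A *v (A *v s) = matrix_inv A *v g + matrix_inv A *v (h - M *v s)"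
    by (simp add: matrix_vector_right_distrib)
  then have "s = matrix_inv A *v g + matrix_inv A *v (h - M *v s)"
    by (simp add: matrix_vector_mul_assoc matrix_inv_left[OF A])
  then have s: "s - matrix_inv A *v g = matrix_inv A *v (h - M *v s)"
    by (metis add_diff_cancel_left')
  have "norm (M *v s) \<le> c * \<epsilon> * mnorm2 A * norm s"
    using norm_matrix_vector_mult_le[of M s] mult_right_mono[OF M, of "norm s"] by simp
  then have "norm (h - M *v s) \<le> c * \<epsilon> * norm g + c * \<epsilon> * mnorm2 A * norm s"
    using norm_triangle_ineq4[of h "M *v s"] h by linarith
  then have "N * norm (h - M *v s) \<le> N * (c * \<epsilon> * norm g + c * \<epsilon> * mnorm2 A * norm s)"
    using N by (intro mult_left_mono) auto
  then show 1: "norm (s - matrix_inv A *v g) \<le> N * (c * (norm g + mnorm2 A * norm s)) * \<epsilon>"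
    using norm_matrix_vector_mult_le[of "matrix_inv A" "h - M *v s"]
    by (simp add: s N_def algebra_simps)
  have "norm s \<le> norm (s - matrix_inv A *v g) + norm (matrix_inv A *v g)"
    using norm_triangle_ineq[of "s - matrix_inv A *v g" "matrix_inv A *v g"] by simp
  also have "\<dots> \<le> N * c * norm g * \<epsilon> + c * \<epsilon> * (N * mnorm2 A) * norm s + N * norm g"
    using 1 norm_matrix_vector_mult_le[of "matrix_inv A" g] by (simp add: N_def algebra_simps)
  \<comment> \<open>By \<open>small\<close>, the term in \<open>norm s\<close> is at most half of
    the left-hand side and is absorbed there, which produces the factor 2.\<close>
  also have "\<dots> \<le> N * c * norm g * 1 + 1/2 * norm s + N * norm g"
    using small N c e by (intro add_mono mult_left_mono mult_right_mono) auto
  finally show "norm s \<le> 2 * N * (1 + c) * norm g" by (simp add: algebra_simps)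
qed

section \<open>The denominator \<beta> and uniform bounds on the computed scalars\<close>

text \<open>If the denominator vanished, z = A^{-1} u would satisfy v^T z = -1, hence be nonzero,
  and yet (A + u v^T) z = u - u = 0.\<close>

lemma sherman_morrison_denominator_nonzero:
  fixes A :: "real^'n^'n"
  assumes A: "invertible A" and B: "invertible (A + outer u v)"
  shows "1 + v \<bullet> (matrix_inv A *v u) \<noteq> 0"
proof
  define z where "z = matrix_inv A *v u"
  assume "1 + v \<bullet> (matrix_inv A *v u) = 0"
  then have vz: "v \<bullet> z = -1" by (simp add: z_def)
  have "A *v z = u" by (simp add: z_def matrix_vector_mul_assoc matrix_inv_right[OF A])
  then have "(A + outer u v) *v z = 0"
    by (simp add: matrix_vector_mult_add_rdistrib outer_mult_vec vz)
  then have "z = 0" using injD[OF inj_matrix_vector_mult[OF B], of z 0] by simp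
  then show False using vz by simp
qed

text \<open>The absolute \<open>O(\<epsilon>\<^sup>2)\<close> term in the bound on \<open>\<Delta>g\<close> needs \<open>\<theta>\<close> and \<open>\<theta>\<^sub>1\<close> to stay bounded
  uniformly over all runs; this holds because the computed \<open>\<beta>\<close> stays away from \<open>0\<close>.\<close>

lemma msm_scalars_bounded:
  fixes A :: "real^'n^'n" and u v b :: "real^'n"
  assumes A: "invertible A" and B: "invertible (A + outer u v)" and c: "0 \<le> c"
  obtains T \<epsilon>\<^sub>0 where "0 \<le> T" "0 < \<epsilon>\<^sub>0"
    "\<And>\<epsilon> (R :: 'n msm_values). \<lbrakk>0 < \<epsilon>; \<epsilon> < \<epsilon>\<^sub>0; msm_run c \<epsilon> A u v b R\<rbrakk>
      \<Longrightarrow> \<bar>theta_hat R\<bar> \<le> T \<and> \<bar>theta1_hat R\<bar> \<le> T"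
proof -
  define N where "N = mnorm2 (matrix_inv A)"
  define a where "a = mnorm2 A"
  define n where "n = real CARD('n)"
  define \<beta> where "\<beta> = 1 + v \<bullet> (matrix_inv A *v u)"
  define Y where "Y = 2 * N * (1 + c) * norm b"
  define Z where "Z = 2 * N * (1 + c) * norm u"
  \<comment> \<open>Chosen so that \<open>1 + vz_hat R\<close> differs from the exact \<beta> by at
    most K\<epsilon>: the first summand comes from rounding the inner product, the second from the
    solve for z.\<close>
  define K where "K = norm v * ((n + 2 * n\<^sup>2) * Z + N * (c * (norm u + a * Z)))"
  \<comment> \<open>Each summand encodes one smallness condition, so that S\<epsilon> < 1 yields all
    four of \<open>e1\<close>, \<open>ne\<close>, \<open>small\<close> and
    \<open>Ke\<close>.\<close>
  define S where "S = 2 + 2 * n + 2 * (c * (N * a)) + 2 * K / \<bar>\<beta>\<bar>"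
  \<comment> \<open>The 16 is 4 from dividing by a computed \<beta> of size at least
    \<open>\<bar>\<beta>\<bar> / 4\<close>, times 2 for the inner product and 2 for the rounded
    quotient. In \<open>T2\<close> the rounded subtraction takes the place of the inner
    product.\<close>
  define T1 where "T1 = 16 * (norm v * Y) / \<bar>\<beta>\<bar>"
  define W where "W = 2 * N * (1 + c) * (2 * (norm b + 2 * (T1 * norm u)))"
  define T2 where "T2 = 16 * (2 * (norm v * W) + T1) / \<bar>\<beta>\<bar>"
  have \<beta>: "0 < \<bar>\<beta>\<bar>"
    using sherman_morrison_denominator_nonzero[OF A B] by (simp add: \<beta>_def)
  have nn: "0 \<le> N" "0 \<le> a" "0 \<le> n" by (simp_all add: N_def a_def n_def mnorm2_nonneg)
  then have nn2: "0 \<le> Y" "0 \<le> Z" "0 \<le> c * (N * a)" using c by (simp_all add: Y_def Z_def)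
  then have K: "0 \<le> K" using nn c by (simp add: K_def)
  have T1: "0 \<le> T1" using nn2 by (simp add: T1_def)
  then have W: "0 \<le> W" using nn c by (simp add: W_def)
  then have T2: "0 \<le> T2" using T1 by (simp add: T2_def)
  have KB: "0 \<le> 2 * K / \<bar>\<beta>\<bar>" using K by simp
  have S: "0 < S" using nn(3) nn2(3) KB unfolding S_def by linarith
  show thesis
  proof (rule that[of "T1 + T2" "1 / S"])
    show "0 \<le> T1 + T2" "0 < 1 / S" using T1 T2 S by auto
  next
    fix \<epsilon> and R :: "'n msm_values"
    assume e: "0 < \<epsilon>" "\<epsilon> < 1 / S" and run: "msm_run c \<epsilon> A u v b R"
    note run = run[unfolded msm_run_def]
    have "S * \<epsilon> < 1" using e S by (simp add: field_simps)
    then have sum: "2 * \<epsilon> + 2 * (n * \<epsilon>) + 2 * (c * (N * a) * \<epsilon>) + 2 * K / \<bar>\<beta>\<bar> * \<epsilon> < 1"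
      by (simp add: S_def algebra_simps)
    have parts: "0 \<le> n * \<epsilon>" "0 \<le> c * (N * a) * \<epsilon>" "0 \<le> 2 * K / \<bar>\<beta>\<bar> * \<epsilon>"
      using nn(3) nn2(3) KB e by (simp_all del: times_divide_eq_left)
    have e1: "\<epsilon> \<le> 1/2" and ne: "real CARD('n) * \<epsilon> \<le> 1/2"
      and small: "c * \<epsilon> * (N * a) \<le> 1/2" and Ke: "2 * K / \<bar>\<beta>\<bar> * \<epsilon> \<le> 1"
      using sum parts e(1) unfolding n_def mult.assoc mult.left_commute[of \<epsilon>] mult.commute[of \<epsilon>]
      by linarith+
    have Ke': "K * \<epsilon> \<le> \<bar>\<beta>\<bar> / 2" using Ke \<beta> by (simp add: field_simps)
    have ee: "0 \<le> \<epsilon>" "\<epsilon> \<le> 1" using e e1 by auto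
    note bounds = backward_stable_solve_bounds[OF _ A c ee small[unfolded N_def a_def],
        folded N_def a_def]
    have y: "norm (y_hat R) \<le> Y"
      using bounds(2) run unfolding Y_def by blast
    have z: "norm (z_hat R) \<le> Z"
      using bounds(2) run unfolding Z_def by blast
    have z': "norm (z_hat R - matrix_inv A *v u) \<le> N * (c * (norm u + a * Z)) * \<epsilon>"
    proof -
      have "norm (z_hat R - matrix_inv A *v u) \<le> N * (c * (norm u + a * norm (z_hat R))) * \<epsilon>"
        using bounds(1) run by blast
      also have "\<dots> \<le> N * (c * (norm u + a * Z)) * \<epsilon>"
        using nn c ee z by (intro mult_left_mono mult_right_mono add_left_mono) auto
      finally show ?thesis .
    qed
    obtain f where f: "\<And>i. \<bar>f i - 1\<bar> \<le> gam CARD('n) \<epsilon>"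
      and vz: "vz_hat R = v \<bullet> (diag f *v z_hat R)"
      using run fl_inner_diag by metis
    have "\<bar>f i - 1\<bar> \<le> (n + 2 * n\<^sup>2) * \<epsilon>" for i
      using f[of i] gam_le_ub[OF ee(1) ne] ub_le_linear[OF ee, of "2 * n\<^sup>2" n]
      by (simp add: n_def)
    then have "norm (diag f *v z_hat R - z_hat R) \<le> (n + 2 * n\<^sup>2) * \<epsilon> * norm (z_hat R)"
      by (rule norm_diag_minus_le)
    also have "\<dots> \<le> (n + 2 * n\<^sup>2) * \<epsilon> * Z"
      using nn ee z by (intro mult_left_mono) auto
    finally have "norm (diag f *v z_hat R - matrix_inv A *v u)
        \<le> ((n + 2 * n\<^sup>2) * Z + N * (c * (norm u + a * Z))) * \<epsilon>"
      using z' norm_triangle_ineq[of "diag f *v z_hat R - z_hat R" "z_hat R - matrix_inv A *v u"]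
      by (simp add: algebra_simps)
    then have "norm v * norm (diag f *v z_hat R - matrix_inv A *v u) \<le> K * \<epsilon>"
      unfolding K_def mult.assoc by (intro mult_left_mono) auto
    moreover have "1 + vz_hat R - \<beta> = v \<bullet> (diag f *v z_hat R - matrix_inv A *v u)"
      by (simp add: vz \<beta>_def inner_diff_right)
    ultimately have "\<bar>1 + vz_hat R - \<beta>\<bar> \<le> \<bar>\<beta>\<bar> / 2"
      using Cauchy_Schwarz_ineq2[of v "diag f *v z_hat R - matrix_inv A *v u"] Ke' by simp
    then have vz2: "\<bar>\<beta>\<bar> / 2 \<le> \<bar>1 + vz_hat R\<bar>" by linarith
    obtain t where t: "\<bar>t - 1\<bar> \<le> \<epsilon>" "beta_hat R = (1 + vz_hat R) * t"
      using run fl_scalar_factor by metis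
    \<comment> \<open>One half of the exact \<beta> may be lost to the error in v^T z, and the
      rounding factor \<open>t\<close> of the addition is still at least 1/2.\<close>
    have "\<bar>\<beta>\<bar> / 2 * (1/2) \<le> \<bar>1 + vz_hat R\<bar> * \<bar>t\<bar>"
      using vz2 t(1) e1 by (intro mult_mono) auto
    then have bh: "\<bar>\<beta>\<bar> / 4 \<le> \<bar>beta_hat R\<bar>" by (simp add: t(2) abs_mult)
    have quot: "\<bar>q / beta_hat R\<bar> \<le> 4 * r / \<bar>\<beta>\<bar>" if "\<bar>q\<bar> \<le> r" for q r
    proof -
      have "\<bar>q\<bar> / \<bar>beta_hat R\<bar> \<le> r / (\<bar>\<beta>\<bar> / 4)"
        using that bh \<beta> by (intro frac_le) auto
      then show ?thesis by (simp add: mult.commute)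
    qed
    have "\<bar>alpha_hat R\<bar> \<le> 2 * (norm v * norm (y_hat R))"
      using run ne fl_inner_abs_le by blast
    also have "\<dots> \<le> 2 * (norm v * Y)" using y by (intro mult_left_mono) auto
    finally have "\<bar>alpha_hat R / beta_hat R\<bar> \<le> 4 * (2 * (norm v * Y)) / \<bar>\<beta>\<bar>" by (rule quot)
    moreover have "\<bar>theta_hat R\<bar> \<le> 2 * \<bar>alpha_hat R / beta_hat R\<bar>"
      using run ee(2) fl_scalar_abs_le by blast
    ultimately have th: "\<bar>theta_hat R\<bar> \<le> T1" by (simp add: T1_def)
    have "norm (ut_hat R) \<le> 2 * norm (theta_hat R *\<^sub>R u)"
      using run ee(2) fl_vec_norm_le by blast
    also have "\<dots> \<le> 2 * (T1 * norm u)" using th by (simp add: mult_right_mono)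
    finally have ut: "norm (ut_hat R) \<le> 2 * (T1 * norm u)" .
    have "norm (d_hat R) \<le> 2 * norm (b - ut_hat R)"
      using run ee(2) fl_vec_norm_le by blast
    also have "norm (b - ut_hat R) \<le> norm b + 2 * (T1 * norm u)"
      using norm_triangle_ineq4[of b "ut_hat R"] ut by (rule order_trans[OF _ add_left_mono])
    finally have d: "norm (d_hat R) \<le> 2 * (norm b + 2 * (T1 * norm u))" by simp
    have "norm (w_hat R) \<le> 2 * N * (1 + c) * norm (d_hat R)"
      using bounds(2) run by blast
    also have "\<dots> \<le> W"
      unfolding W_def using nn c d by (intro mult_left_mono) auto
    finally have w: "norm (w_hat R) \<le> W" .
    have "\<bar>vw_hat R\<bar> \<le> 2 * (norm v * norm (w_hat R))"
      using run ne fl_inner_abs_le by blast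
    also have "\<dots> \<le> 2 * (norm v * W)" using w by (intro mult_left_mono) auto
    finally have "\<bar>vw_hat R - theta_hat R\<bar> \<le> 2 * (norm v * W) + T1" using th by linarith
    moreover have "\<bar>num_hat R\<bar> \<le> 2 * \<bar>vw_hat R - theta_hat R\<bar>"
      using run ee(2) fl_scalar_abs_le by blast
    ultimately have "\<bar>num_hat R\<bar> \<le> 2 * (2 * (norm v * W) + T1)"
      by (meson mult_left_mono order_trans zero_le_numeral)
    then have "\<bar>num_hat R / beta_hat R\<bar> \<le> 4 * (2 * (2 * (norm v * W) + T1)) / \<bar>\<beta>\<bar>" by (rule quot)
    moreover have "\<bar>theta1_hat R\<bar> \<le> 2 * \<bar>num_hat R / beta_hat R\<bar>"
      using run ee(2) fl_scalar_abs_le by blast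
    ultimately have "\<bar>theta1_hat R\<bar> \<le> 2 * (4 * (2 * (2 * (norm v * W) + T1)) / \<bar>\<beta>\<bar>)"
      by (meson mult_left_mono order_trans zero_le_numeral)
    then have "\<bar>theta1_hat R\<bar> \<le> T2" by (simp add: T2_def)
    then show "\<bar>theta_hat R\<bar> \<le> T1 + T2 \<and> \<bar>theta1_hat R\<bar> \<le> T1 + T2"
      using th T1 T2 by linarith
  qed
qed

section \<open>Backward error of a run\<close>

text \<open>Since \<open>diag f\<^sub>4 *v x\<close> is w - p, the left side is
  \<open>M\<^sub>2\<close> applied to w - p plus a multiple of the perturbed \<open>u\<close>.
  Inserting the system for w and the equation for \<theta> cancels \<theta>; the system for z then
  makes the remaining \<theta>_1 terms linear in p, up to \<open>g\<^sub>1\<close>. The matrix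
  \<open>A\<close> is only a reference point that cancels on each side.\<close>

lemma msm_perturbed_identity:
  fixes A M\<^sub>1 M\<^sub>2 E :: "real^'n^'n" and u v b p x z w d g\<^sub>1 g\<^sub>2 :: "real^'n"
    and \<theta> \<theta>\<^sub>1 h :: real
  assumes z: "M\<^sub>1 *v z = u + g\<^sub>1" and w: "M\<^sub>2 *v w = d + g\<^sub>2"
    and d: "d = E *v b - \<theta> *\<^sub>R (diag k *v u)"
    and th: "\<theta> = v \<bullet> (diag dw *v w) - h * \<theta>\<^sub>1 * (1 + v \<bullet> (diag dz *v z))"
    and zp: "\<theta>\<^sub>1 *\<^sub>R z = diag f\<^sub>3 *v p" and wp: "w = p + diag f\<^sub>4 *v x"
  shows "(A + (M\<^sub>2 ** diag f\<^sub>4 - A)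
      + outer (u + (diag k *v u - u)) (v + (diag (\<lambda>i. dw i * f\<^sub>4 i) *v v - v))) *v x
    = b + (E *v b - b)
      + ((diag (\<lambda>i. h * k i) ** (M\<^sub>1 ** diag f\<^sub>3) - A) - (M\<^sub>2 - A)
         - outer (diag k *v u) (diag (\<lambda>i. dw i - h * dz i * f\<^sub>3 i) *v v)) *v p
      + (g\<^sub>2 - \<theta>\<^sub>1 *\<^sub>R (diag (\<lambda>i. h * k i) *v g\<^sub>1))"
    (is "?L *v x = b + ?\<Delta>b + ?G *v p + ?\<Delta>g")
proof -
  let ?U = "diag k *v u"
  have x: "diag f\<^sub>4 *v x = w - p" using wp by simp
  have "(diag (\<lambda>i. dw i * f\<^sub>4 i) *v v) \<bullet> x = v \<bullet> (diag dw *v (w - p))"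
    by (simp add: inner_diag[symmetric] diag_mult_diag_vec x[symmetric])
  then have L: "?L *v x = M\<^sub>2 *v (w - p) + (v \<bullet> (diag dw *v (w - p))) *\<^sub>R ?U"
    by (simp add: matrix_vector_mult_add_rdistrib outer_mult_vec matrix_vector_mul_assoc[symmetric] x)
  \<comment> \<open>Scaling the system for z by \<theta>_1 expresses
    \<open>\<theta>\<^sub>1 *\<^sub>R u\<close> through p; this is where the correction vector
    enters the right-hand side.\<close>
  have M1: "M\<^sub>1 *v (diag f\<^sub>3 *v p) = \<theta>\<^sub>1 *\<^sub>R (u + g\<^sub>1)"
    by (simp add: zp[symmetric] matrix_vector_mult_scaleR z)
  have hk: "diag (\<lambda>i. h * k i) *v y = h *\<^sub>R (diag k *v y)" for y
    by (simp add: vec_eq_iff)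
  have "diag (\<lambda>i. dw i - h * dz i * f\<^sub>3 i) *v p = diag dw *v p - h *\<^sub>R (diag dz *v (diag f\<^sub>3 *v p))"
    by (simp add: vec_eq_iff algebra_simps)
  then have inn: "(diag (\<lambda>i. dw i - h * dz i * f\<^sub>3 i) *v v) \<bullet> p
      = v \<bullet> (diag dw *v p) - h * \<theta>\<^sub>1 * (v \<bullet> (diag dz *v z))"
    by (simp add: inner_diag[symmetric] zp[symmetric] inner_diff_right matrix_vector_mult_scaleR)
  have "?G *v p = (h * \<theta>\<^sub>1) *\<^sub>R (diag k *v (u + g\<^sub>1)) - M\<^sub>2 *v p
      - (v \<bullet> (diag dw *v p) - h * \<theta>\<^sub>1 * (v \<bullet> (diag dz *v z))) *\<^sub>R ?U"
    by (simp add: matrix_vector_mult_diff_rdistrib outer_mult_vec inn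
        matrix_vector_mul_assoc[symmetric] M1 hk matrix_vector_mult_scaleR)
  \<comment> \<open>The \<theta> appearing here cancels the one in d, which enters through
    \<open>M\<^sub>2 *v w\<close>.\<close>
  moreover have "v \<bullet> (diag dw *v (w - p)) = \<theta> + h * \<theta>\<^sub>1 * (1 + v \<bullet> (diag dz *v z)) - v \<bullet> (diag dw *v p)"
    by (simp add: th matrix_vector_mult_diff_distrib inner_diff_right)
  ultimately show ?thesis
    unfolding L by (simp add: matrix_vector_mult_diff_distrib w d hk matrix_vector_right_distrib
        algebra_simps)
qed

text \<open>Each coefficient in \<open>ub\<close> counts roundings: two in \<open>k\<close> (the
  product by \<theta> and the subtraction from b), three in \<open>h\<close> (the addition in
  \<beta>, the subtraction and the division in \<theta>_1), and one each in \<open>f\<^sub>3\<close>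
  and \<open>f\<^sub>4\<close>.\<close>

lemma msm_run_factors:
  fixes A :: "real^'n^'n" and u v b :: "real^'n" and R :: "'n msm_values"
  assumes run: "msm_run c \<epsilon> A u v b R" and \<beta>: "beta_hat R \<noteq> 0"
    and e: "0 \<le> \<epsilon>" "\<epsilon> \<le> 1/2"
  obtains M\<^sub>1 M\<^sub>2 :: "real^'n^'n" and g\<^sub>1 g\<^sub>2 :: "real^'n" and e k dw dz f\<^sub>3 f\<^sub>4 :: "'n \<Rightarrow> real" and h
  where "M\<^sub>1 *v z_hat R = u + g\<^sub>1" "mnorm2 (M\<^sub>1 - A) \<le> ub c 0 \<epsilon> * mnorm2 A"
      "norm g\<^sub>1 \<le> c * \<epsilon> * norm u"
    and "M\<^sub>2 *v w_hat R = d_hat R + g\<^sub>2" "mnorm2 (M\<^sub>2 - A) \<le> ub c 0 \<epsilon> * mnorm2 A"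
      "norm g\<^sub>2 \<le> c * \<epsilon> * norm (d_hat R)"
    and "d_hat R = diag e *v b - theta_hat R *\<^sub>R (diag k *v u)"
      "\<And>i. \<bar>e i - 1\<bar> \<le> \<epsilon>" "\<And>i. \<bar>k i - 1\<bar> \<le> ub 2 1 \<epsilon>"
    and "theta_hat R = v \<bullet> (diag dw *v w_hat R) - h * theta1_hat R * (1 + v \<bullet> (diag dz *v z_hat R))"
      "\<And>i. \<bar>dw i - 1\<bar> \<le> gam CARD('n) \<epsilon>" "\<And>i. \<bar>dz i - 1\<bar> \<le> gam CARD('n) \<epsilon>"
      "\<bar>h - 1\<bar> \<le> ub 3 28 \<epsilon>"
    and "theta1_hat R *\<^sub>R z_hat R = diag f\<^sub>3 *v p_hat R" "\<And>i. \<bar>f\<^sub>3 i - 1\<bar> \<le> ub 1 2 \<epsilon>"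
    and "w_hat R = p_hat R + diag f\<^sub>4 *v x_hat R" "\<And>i. \<bar>f\<^sub>4 i - 1\<bar> \<le> ub 1 2 \<epsilon>"
proof -
  note run = run[unfolded msm_run_def]
  have e1: "\<epsilon> \<le> 1" using e by simp
  have solve: "\<exists>M g. M *v s = r + g \<and> mnorm2 (M - A) \<le> ub c 0 \<epsilon> * mnorm2 A \<and> norm g \<le> c * \<epsilon> * norm r"
    if s: "backward_stable_solve c \<epsilon> A r s" for r s
  proof -
    obtain D g where D: "(A + D) *v s = r + g" "mnorm2 D \<le> c * \<epsilon> * mnorm2 A"
      "norm g \<le> c * \<epsilon> * norm r"
      using s unfolding backward_stable_solve_def by blast
    show ?thesis by (rule exI[of _ "A + D"], rule exI[of _ g]) (use D in \<open>simp add: ub_def\<close>)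
  qed
  obtain M\<^sub>1 g\<^sub>1 where 1: "M\<^sub>1 *v z_hat R = u + g\<^sub>1" "mnorm2 (M\<^sub>1 - A) \<le> ub c 0 \<epsilon> * mnorm2 A"
    "norm g\<^sub>1 \<le> c * \<epsilon> * norm u"
    using solve run by blast
  obtain M\<^sub>2 g\<^sub>2 where 2: "M\<^sub>2 *v w_hat R = d_hat R + g\<^sub>2" "mnorm2 (M\<^sub>2 - A) \<le> ub c 0 \<epsilon> * mnorm2 A"
    "norm g\<^sub>2 \<le> c * \<epsilon> * norm (d_hat R)"
    using solve run by blast
  obtain k' where k': "\<And>i. \<bar>k' i - 1\<bar> \<le> \<epsilon>" "ut_hat R = diag k' *v (theta_hat R *\<^sub>R u)"
    using run fl_vec_diag by metis
  obtain e where e': "\<And>i. \<bar>e i - 1\<bar> \<le> \<epsilon>" "d_hat R = diag e *v (b - ut_hat R)"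
    using run fl_vec_diag by metis
  have d: "d_hat R = diag e *v b - theta_hat R *\<^sub>R (diag (\<lambda>i. e i * k' i) *v u)"
    by (simp add: e' k' vec_eq_iff algebra_simps)
  have k: "\<bar>e i * k' i - 1\<bar> \<le> ub 2 1 \<epsilon>" for i
    using near_one_mult[of "e i" 1 0 \<epsilon> "k' i" 1 0] e'(1)[of i] k'(1)[of i] e(1) e1
    by (simp add: ub_def ub_const_def)
  obtain dw where dw: "\<And>i. \<bar>dw i - 1\<bar> \<le> gam CARD('n) \<epsilon>" "vw_hat R = v \<bullet> (diag dw *v w_hat R)"
    using run fl_inner_diag by metis
  obtain dz where dz: "\<And>i. \<bar>dz i - 1\<bar> \<le> gam CARD('n) \<epsilon>" "vz_hat R = v \<bullet> (diag dz *v z_hat R)"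
    using run fl_inner_diag by metis
  obtain t\<^sub>1 where t1: "\<bar>t\<^sub>1 - 1\<bar> \<le> \<epsilon>" "num_hat R = (vw_hat R - theta_hat R) * t\<^sub>1"
    using run fl_scalar_factor by metis
  obtain t\<^sub>2 where t2: "\<bar>t\<^sub>2 - 1\<bar> \<le> \<epsilon>" "theta1_hat R = num_hat R / beta_hat R * t\<^sub>2"
    using run fl_scalar_factor by metis
  obtain t\<^sub>3 where t3: "\<bar>t\<^sub>3 - 1\<bar> \<le> \<epsilon>" "beta_hat R = (1 + vz_hat R) * t\<^sub>3"
    using run fl_scalar_factor by metis
  \<comment> \<open>The rounding of \<beta> enters directly and the two roundings of \<theta>_1
    inversely. The quadratic constants below are \<open>ub_const 1 0 1 2\<close> = 5 and
    \<open>ub_const 2 5 1 2\<close> = 28.\<close>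
  define h where "h = t\<^sub>3 * inverse t\<^sub>1 * inverse t\<^sub>2"
  note i1 = near_one_inverse[OF t1(1) e(2)] and i2 = near_one_inverse[OF t2(1) e(2)]
  have "\<bar>t\<^sub>3 * inverse t\<^sub>1 - 1\<bar> \<le> ub 2 5 \<epsilon>"
    using near_one_mult[of t\<^sub>3 1 0 \<epsilon> "inverse t\<^sub>1" 1 2] i1(1) t3(1) e(1) e1
    by (simp add: ub_def ub_const_def)
  then have "\<bar>h - 1\<bar> \<le> ub 3 28 \<epsilon>"
    using near_one_mult[of "t\<^sub>3 * inverse t\<^sub>1" 2 5 \<epsilon> "inverse t\<^sub>2" 1 2] i2(1) e(1) e1
    by (simp add: h_def ub_const_def)
  \<comment> \<open>Clearing the division by the computed \<beta> allows the equation for \<theta>_1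
    to be solved for \<theta>.\<close>
  moreover have "theta1_hat R * beta_hat R = (vw_hat R - theta_hat R) * t\<^sub>1 * t\<^sub>2"
    using \<beta> by (simp add: t2(2) t1(2))
  then have "theta_hat R = vw_hat R - h * theta1_hat R * (1 + vz_hat R)"
    using i1(2) i2(2) by (simp add: h_def t3(2) field_simps)
  ultimately have th: "theta_hat R = v \<bullet> (diag dw *v w_hat R)
      - h * theta1_hat R * (1 + v \<bullet> (diag dz *v z_hat R))" "\<bar>h - 1\<bar> \<le> ub 3 28 \<epsilon>"
    using dw dz by simp_all
  obtain q where q: "\<And>i. \<bar>q i - 1\<bar> \<le> \<epsilon>" "p_hat R = diag q *v (theta1_hat R *\<^sub>R z_hat R)"
    using run fl_vec_diag by metis
  obtain r where r: "\<And>i. \<bar>r i - 1\<bar> \<le> \<epsilon>" "x_hat R = diag r *v (w_hat R - p_hat R)"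
    using run fl_vec_diag by metis
  note iq = near_one_inverse[OF q(1) e(2)] and ir = near_one_inverse[OF r(1) e(2)]
  \<comment> \<open>The rounding is inverted, so that z and w are expressed in the computed p and
    x.\<close>
  have zp: "theta1_hat R *\<^sub>R z_hat R = diag (\<lambda>i. inverse (q i)) *v p_hat R"
    using iq(2) by (simp add: q(2) vec_eq_iff)
  have wp: "w_hat R = p_hat R + diag (\<lambda>i. inverse (r i)) *v x_hat R"
    using ir(2) by (simp add: r(2) vec_eq_iff mult.assoc[symmetric])
  show thesis
    by (rule that[OF 1 2 d e'(1) k th(1) dw(1) dz(1) th(2) zp iq(1) wp ir(1)])
qed

section \<open>Assembling the six bounds with one constant\<close>

theorem theorem4p1:
  fixes A :: "real^'n^'n" and u v b :: "real^'n" and c\<^sub>s :: real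
  assumes "invertible A"
    and "invertible (A + outer u v)"
  shows "\<exists>C \<epsilon>\<^sub>0. C \<ge> 0 \<and> \<epsilon>\<^sub>0 > 0 \<and>
    (\<forall>\<epsilon> (R :: 'n msm_values).
      0 < \<epsilon> \<and> \<epsilon> < \<epsilon>\<^sub>0 \<and> real CARD('n) * \<epsilon> < 1 \<and>
      msm_run c\<^sub>s \<epsilon> A u v b R \<and> beta_hat R \<noteq> 0 \<longrightarrow>
      (\<exists>(\<Delta>A :: real^'n^'n) (\<Delta>G :: real^'n^'n)
         (\<Delta>u :: real^'n) (\<Delta>v :: real^'n) (\<Delta>b :: real^'n) (\<Delta>g :: real^'n).
        (A + \<Delta>A + outer (u + \<Delta>u) (v + \<Delta>v)) *v x_hat R = b + \<Delta>b + \<Delta>G *v p_hat R + \<Delta>g \<and>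
        mnorm2 \<Delta>A \<le> ((1 + c\<^sub>s) * \<epsilon> + C * \<epsilon>\<^sup>2) * mnorm2 A \<and>
        norm \<Delta>u \<le> (2 * \<epsilon> + C * \<epsilon>\<^sup>2) * norm u \<and>
        norm \<Delta>v \<le> ((real CARD('n) + 1) * \<epsilon> + C * \<epsilon>\<^sup>2) * norm v \<and>
        norm \<Delta>b \<le> \<epsilon> * norm b \<and>
        mnorm2 \<Delta>G \<le> ((6 + 2 * c\<^sub>s) * \<epsilon> + C * \<epsilon>\<^sup>2) * mnorm2 A
                   + ((2 * real CARD('n) + 4) * \<epsilon> + C * \<epsilon>\<^sup>2) * (norm u * norm v) \<and>
        norm \<Delta>g \<le> c\<^sub>s * \<epsilon> * (norm b + norm u * (\<bar>theta_hat R\<bar> + \<bar>theta1_hat R\<bar>)) + C * \<epsilon>\<^sup>2))"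
proof (cases "0 \<le> c\<^sub>s")
  \<comment> \<open>No run exists for a negative constant, so the claim is vacuous.\<close>
  case False
  have "\<not> msm_run c\<^sub>s \<epsilon> A u v b R" if "0 < \<epsilon>" for \<epsilon> and R :: "'n msm_values"
    using backward_stable_solve_const_nonneg[OF _ assms(1) that] False
    unfolding msm_run_def by blast
  then show ?thesis by (intro exI[of _ 1]) auto
next
  case c: True
  obtain T \<epsilon>\<^sub>1 where T: "0 \<le> T" "0 < \<epsilon>\<^sub>1"
    "\<And>\<epsilon> (R :: 'n msm_values). \<lbrakk>0 < \<epsilon>; \<epsilon> < \<epsilon>\<^sub>1; msm_run c\<^sub>s \<epsilon> A u v b R\<rbrakk>
      \<Longrightarrow> \<bar>theta_hat R\<bar> \<le> T \<and> \<bar>theta1_hat R\<bar> \<le> T"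
    using msm_scalars_bounded[OF assms c] by blast
  define n where "n = real CARD('n)"
  define Kn where "Kn = 2 * n\<^sup>2"
  define K\<^sub>1 where "K\<^sub>1 = ub_const c\<^sub>s 0 1 2"
  define Kv where "Kv = ub_const n Kn 1 2"
  define Khk where "Khk = ub_const 3 28 2 1"
  define Kz where "Kz = ub_const 3 28 n Kn"
  define Ko where "Ko = ub_const (3 + n) Kz 1 2"
  define KG where "KG = ub_const (c\<^sub>s + 1) K\<^sub>1 5 Khk"
  \<comment> \<open>The last summand bounds the product of the errors in \<open>U\<close> and
    \<open>V\<close>; the rest is the quadratic part of \<open>V\<close> alone.\<close>
  define Kout where "Kout = Kn + Ko + (2 + 1) * (2 * n + 4 + (Kn + Ko))"
  \<comment> \<open>Collects the second-order parts: the rounding of b, the factor \<open>k\<close>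
    on \<theta>u (at most 3\<epsilon>), and the factor \<open>h * k i\<close> on
    \<open>g\<^sub>1\<close>.\<close>
  define Kg where "Kg = c\<^sub>s * (norm b + 3 * (T * norm u) + (5 + Khk) * (T * norm u))"
  define C where "C = 1 + Kv + KG + K\<^sub>1 + Kout + Kg"
  have n: "1 \<le> n" by (simp add: n_def)
  have nn: "0 \<le> Kn" "0 \<le> K\<^sub>1" "0 \<le> Khk"
    using c n by (auto simp: Kn_def K\<^sub>1_def Khk_def intro!: ub_const_nonneg)
  have nn2: "0 \<le> Kv" "0 \<le> Kz" "0 \<le> KG"
    using c n nn by (auto simp: Kv_def Kz_def KG_def intro!: ub_const_nonneg)
  have Ko: "0 \<le> Ko" using n nn2 by (auto simp: Ko_def intro!: ub_const_nonneg)
  have nn3: "0 \<le> Kout" "0 \<le> Kg" using n nn Ko c T(1) by (simp_all add: Kout_def Kg_def)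
  have C: "0 \<le> C" "1 \<le> C" "Kv \<le> C" "KG \<le> C" "K\<^sub>1 \<le> C" "Kout \<le> C" "Kg \<le> C"
    using nn nn2 nn3 by (simp_all add: C_def)
  show ?thesis
  \<comment> \<open>The threshold 1/(2n) gives n\<epsilon> \<le> 1/2, and \<epsilon> \<le> 1/2 as
    well because n is at least 1.\<close>
  proof (rule exI[of _ C], rule exI[of _ "min \<epsilon>\<^sub>1 (1 / (2 * n))"], intro conjI allI impI)
    show "0 \<le> C" by fact
    show "0 < min \<epsilon>\<^sub>1 (1 / (2 * n))" using T(2) n by simp
  next
    fix \<epsilon> and R :: "'n msm_values"
    assume "0 < \<epsilon> \<and> \<epsilon> < min \<epsilon>\<^sub>1 (1 / (2 * n)) \<and> real CARD('n) * \<epsilon> < 1 \<and>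
      msm_run c\<^sub>s \<epsilon> A u v b R \<and> beta_hat R \<noteq> 0"
    then have e: "0 < \<epsilon>" "\<epsilon> < \<epsilon>\<^sub>1" "\<epsilon> < 1 / (2 * n)" and run: "msm_run c\<^sub>s \<epsilon> A u v b R"
      and \<beta>: "beta_hat R \<noteq> 0" by auto
    have ne: "n * \<epsilon> \<le> 1/2" using e(3) n by (simp add: field_simps)
    have e0: "0 \<le> \<epsilon>" using e by simp
    have e2: "\<epsilon> \<le> 1/2" using ne mult_right_mono[OF n e0] by simp
    then have e1: "\<epsilon> \<le> 1" by simp
    define \<theta> where "\<theta> = theta_hat R"
    define \<theta>\<^sub>1 where "\<theta>\<^sub>1 = theta1_hat R"
    have th_le: "\<bar>\<theta>\<bar> \<le> T" "\<bar>\<theta>\<^sub>1\<bar> \<le> T" using T(3)[OF e(1,2) run] by (simp_all add: \<theta>_def \<theta>\<^sub>1_def)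
    obtain M\<^sub>1 M\<^sub>2 g\<^sub>1 g\<^sub>2 e k dw dz f\<^sub>3 f\<^sub>4 h
      where z: "M\<^sub>1 *v z_hat R = u + g\<^sub>1" and M1: "mnorm2 (M\<^sub>1 - A) \<le> ub c\<^sub>s 0 \<epsilon> * mnorm2 A"
      and g1: "norm g\<^sub>1 \<le> c\<^sub>s * \<epsilon> * norm u"
      and w: "M\<^sub>2 *v w_hat R = d_hat R + g\<^sub>2" and M2: "mnorm2 (M\<^sub>2 - A) \<le> ub c\<^sub>s 0 \<epsilon> * mnorm2 A"
      and g2: "norm g\<^sub>2 \<le> c\<^sub>s * \<epsilon> * norm (d_hat R)"
      and d: "d_hat R = diag e *v b - \<theta> *\<^sub>R (diag k *v u)"
      and e: "\<And>i. \<bar>e i - 1\<bar> \<le> \<epsilon>" and k: "\<And>i. \<bar>k i - 1\<bar> \<le> ub 2 1 \<epsilon>"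
      and th: "\<theta> = v \<bullet> (diag dw *v w_hat R) - h * \<theta>\<^sub>1 * (1 + v \<bullet> (diag dz *v z_hat R))"
      and dw': "\<And>i. \<bar>dw i - 1\<bar> \<le> gam CARD('n) \<epsilon>" and dz': "\<And>i. \<bar>dz i - 1\<bar> \<le> gam CARD('n) \<epsilon>"
      and h: "\<bar>h - 1\<bar> \<le> ub 3 28 \<epsilon>"
      and zp: "\<theta>\<^sub>1 *\<^sub>R z_hat R = diag f\<^sub>3 *v p_hat R" and f3: "\<And>i. \<bar>f\<^sub>3 i - 1\<bar> \<le> ub 1 2 \<epsilon>"
      and wp: "w_hat R = p_hat R + diag f\<^sub>4 *v x_hat R" and f4: "\<And>i. \<bar>f\<^sub>4 i - 1\<bar> \<le> ub 1 2 \<epsilon>"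
      unfolding \<theta>_def \<theta>\<^sub>1_def using msm_run_factors[OF run \<beta> e0 e2] by metis
    have gam: "gam CARD('n) \<epsilon> \<le> ub n Kn \<epsilon>"
      using gam_le_ub[OF e0 ne[unfolded n_def]] by (simp add: n_def Kn_def)
    have dw: "\<bar>dw i - 1\<bar> \<le> ub n Kn \<epsilon>" and dz: "\<bar>dz i - 1\<bar> \<le> ub n Kn \<epsilon>" for i
      using dw'[of i] dz'[of i] gam by linarith+
    have n0: "0 \<le> n" using n by simp
    have hk: "\<bar>h * k i - 1\<bar> \<le> ub 5 Khk \<epsilon>" for i
      using near_one_mult[OF h k[of i] e0 e1] by (simp add: Khk_def)
    have "\<bar>h * dz i - 1\<bar> \<le> ub (3 + n) Kz \<epsilon>" for i
      unfolding Kz_def using n0 nn by (intro near_one_mult h dz e0 e1) auto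
    then have hdz: "\<bar>h * dz i * f\<^sub>3 i - 1\<bar> \<le> ub (3 + n + 1) Ko \<epsilon>" for i
      unfolding Ko_def using n0 nn2 by (intro near_one_mult f3 e0 e1) auto
    define U where "U = diag k *v u"
    define V where "V = diag (\<lambda>i. dw i - h * dz i * f\<^sub>3 i) *v v"
    define \<Delta>A where "\<Delta>A = M\<^sub>2 ** diag f\<^sub>4 - A"
    define \<Delta>G\<^sub>1 where "\<Delta>G\<^sub>1 = diag (\<lambda>i. h * k i) ** (M\<^sub>1 ** diag f\<^sub>3) - A"
    define \<Delta>g where "\<Delta>g = g\<^sub>2 - \<theta>\<^sub>1 *\<^sub>R (diag (\<lambda>i. h * k i) *v g\<^sub>1)"
    have ub_c: "0 \<le> ub c\<^sub>s 0 \<epsilon>" using c e0 by (intro ub_nonneg) auto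
    have comb: "ub c\<^sub>s 0 \<epsilon> + ub 1 2 \<epsilon> + ub c\<^sub>s 0 \<epsilon> * ub 1 2 \<epsilon> \<le> ub (c\<^sub>s + 1) K\<^sub>1 \<epsilon>"
      unfolding K\<^sub>1_def using c by (intro ub_combine e0 e1) auto
    have 1: "mnorm2 \<Delta>A \<le> ub (c\<^sub>s + 1) C \<epsilon> * mnorm2 A"
      unfolding \<Delta>A_def using mnorm2_mult_diag_minus_le(1)[OF M2 ub_c, where f = f\<^sub>4, OF f4]
        mult_right_mono[OF order_trans[OF comb ub_mono[OF C(5)]] mnorm2_nonneg[of A]] by linarith
    have MF: "mnorm2 (M\<^sub>1 ** diag f\<^sub>3 - A) \<le> ub (c\<^sub>s + 1) K\<^sub>1 \<epsilon> * mnorm2 A"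
      using mnorm2_mult_diag_minus_le(1)[OF M1 ub_c, where f = f\<^sub>3, OF f3]
        mult_right_mono[OF comb mnorm2_nonneg[of A]] by linarith
    have "0 \<le> ub (c\<^sub>s + 1) K\<^sub>1 \<epsilon>" using c nn e0 by (intro ub_nonneg) auto
    note G = mnorm2_mult_diag_minus_le(2)[OF MF this, where f = "\<lambda>i. h * k i", OF hk]
    have "ub (c\<^sub>s + 1) K\<^sub>1 \<epsilon> + ub 5 Khk \<epsilon> + ub (c\<^sub>s + 1) K\<^sub>1 \<epsilon> * ub 5 Khk \<epsilon> \<le> ub (c\<^sub>s + 1 + 5) KG \<epsilon>"
      unfolding KG_def using c nn by (intro ub_combine e0 e1) auto
    also have "\<dots> \<le> ub (c\<^sub>s + 1 + 5) C \<epsilon>" by (rule ub_mono[OF C(4)])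
    finally have "(ub (c\<^sub>s + 1) K\<^sub>1 \<epsilon> + ub 5 Khk \<epsilon> + ub (c\<^sub>s + 1) K\<^sub>1 \<epsilon> * ub 5 Khk \<epsilon>) * mnorm2 A
        \<le> ub (c\<^sub>s + 1 + 5) C \<epsilon> * mnorm2 A" by (rule mult_right_mono[OF _ mnorm2_nonneg])
    with G have G1: "mnorm2 \<Delta>G\<^sub>1 \<le> ub (c\<^sub>s + 1 + 5) C \<epsilon> * mnorm2 A" unfolding \<Delta>G\<^sub>1_def by linarith
    have U: "norm U \<le> (1 + ub 2 1 \<epsilon>) * norm u" unfolding U_def by (intro norm_diag_near_le k)
    \<comment> \<open>Both factors in the difference are near 1, so the ones cancel and
      \<open>V\<close> is of first order. The coefficient is n for \<open>dw\<close> plus 3 + n + 1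
      for \<open>h\<close>, \<open>dz\<close> and \<open>f\<^sub>3\<close>.\<close>
    have V: "norm V \<le> ub (2 * n + 4) (Kn + Ko) \<epsilon> * norm v"
      unfolding V_def
    proof (rule norm_diag_mult_vec_le)
      have "ub n Kn \<epsilon> + ub (3 + n + 1) Ko \<epsilon> = ub (2 * n + 4) (Kn + Ko) \<epsilon>"
        by (simp add: ub_def algebra_simps)
      then show "\<bar>dw i - h * dz i * f\<^sub>3 i\<bar> \<le> ub (2 * n + 4) (Kn + Ko) \<epsilon>" for i
        using dw[of i] hdz[of i] by linarith
    qed
    have ub2: "0 \<le> ub 2 1 \<epsilon>" using e0 by (intro ub_nonneg) auto
    have ubn: "0 \<le> ub (2 * n + 4) (Kn + Ko) \<epsilon>" using e0 n nn Ko by (intro ub_nonneg) auto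
    have "mnorm2 (outer U V) \<le> norm U * norm V" by (rule mnorm2_outer_le)
    also have "\<dots> \<le> ((1 + ub 2 1 \<epsilon>) * norm u) * (ub (2 * n + 4) (Kn + Ko) \<epsilon> * norm v)"
      using U V ub2 by (intro mult_mono) auto
    also have "\<dots> = (ub (2 * n + 4) (Kn + Ko) \<epsilon> + ub 2 1 \<epsilon> * ub (2 * n + 4) (Kn + Ko) \<epsilon>) * (norm u * norm v)"
      by (simp add: algebra_simps)
    also have "\<dots> \<le> ub (2 * n + 4) Kout \<epsilon> * (norm u * norm v)"
    proof (rule mult_right_mono)
      have "ub 2 1 \<epsilon> * ub (2 * n + 4) (Kn + Ko) \<epsilon> \<le> (2 + 1) * (2 * n + 4 + (Kn + Ko)) * \<epsilon>\<^sup>2"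
        using n nn Ko by (intro ub_mult_le e0 e1) auto
      then show "ub (2 * n + 4) (Kn + Ko) \<epsilon> + ub 2 1 \<epsilon> * ub (2 * n + 4) (Kn + Ko) \<epsilon> \<le> ub (2 * n + 4) Kout \<epsilon>"
        by (simp add: Kout_def ub_def algebra_simps)
    qed simp
    also have "\<dots> \<le> ub (2 * n + 4) C \<epsilon> * (norm u * norm v)"
      by (intro mult_right_mono ub_mono C) simp
    finally have O: "mnorm2 (outer U V) \<le> ub (2 * n + 4) C \<epsilon> * (norm u * norm v)" .
    \<comment> \<open>The leading coefficient 6 + 2\<open>c\<^sub>s\<close> of the norm of
      \<open>A\<close> is made of \<open>c\<^sub>s\<close> for each of \<open>M\<^sub>1\<close> and
      \<open>M\<^sub>2\<close>, 1 for \<open>f\<^sub>3\<close>, 3 for \<open>h\<close> and 2 for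
      \<open>k\<close>.\<close>
    have "mnorm2 (\<Delta>G\<^sub>1 - (M\<^sub>2 - A) - outer U V)
        \<le> mnorm2 \<Delta>G\<^sub>1 + mnorm2 (M\<^sub>2 - A) + mnorm2 (outer U V)"
      using mnorm2_diff_le[of "\<Delta>G\<^sub>1 - (M\<^sub>2 - A)" "outer U V"] mnorm2_diff_le[of \<Delta>G\<^sub>1 "M\<^sub>2 - A"]
      by linarith
    also have "\<dots> \<le> ub (c\<^sub>s + 1 + 5) C \<epsilon> * mnorm2 A + ub c\<^sub>s 0 \<epsilon> * mnorm2 A
        + ub (2 * n + 4) C \<epsilon> * (norm u * norm v)"
      using G1 M2 O by linarith
    also have "\<dots> = ub (6 + 2 * c\<^sub>s) C \<epsilon> * mnorm2 A + ub (2 * n + 4) C \<epsilon> * (norm u * norm v)"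
      by (simp add: ub_def algebra_simps)
    finally have 2: "mnorm2 (\<Delta>G\<^sub>1 - (M\<^sub>2 - A) - outer U V)
        \<le> ub (6 + 2 * c\<^sub>s) C \<epsilon> * mnorm2 A + ub (2 * n + 4) C \<epsilon> * (norm u * norm v)" .
    have k': "\<bar>k i - 1\<bar> \<le> ub 2 C \<epsilon>" for i using k[of i] ub_mono[OF C(2)] order_trans by blast
    have 3: "norm (U - u) \<le> ub 2 C \<epsilon> * norm u"
      unfolding U_def by (intro norm_diag_minus_le k')
    \<comment> \<open>The n comes from the inner product with w, the 1 from the final
      subtraction.\<close>
    have "\<bar>dw i * f\<^sub>4 i - 1\<bar> \<le> ub (n + 1) Kv \<epsilon>" for i
      unfolding Kv_def using n0 nn by (intro near_one_mult dw f4 e0 e1) auto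
    then have "\<bar>dw i * f\<^sub>4 i - 1\<bar> \<le> ub (n + 1) C \<epsilon>" for i using ub_mono[OF C(3)] order_trans by blast
    then have 4: "norm (diag (\<lambda>i. dw i * f\<^sub>4 i) *v v - v) \<le> ub (n + 1) C \<epsilon> * norm v"
      by (rule norm_diag_minus_le)
    have 5: "norm (diag e *v b - b) \<le> \<epsilon> * norm b" by (intro norm_diag_minus_le e)
    have ce: "0 \<le> c\<^sub>s * \<epsilon>" using c e0 by simp
    have "norm (d_hat R) \<le> norm (diag e *v b) + \<bar>\<theta>\<bar> * norm U"
      unfolding d U_def using norm_triangle_ineq4[of "diag e *v b" "\<theta> *\<^sub>R (diag k *v u)"] by simp
    also have "\<dots> \<le> (1 + \<epsilon>) * norm b + \<bar>\<theta>\<bar> * ((1 + ub 2 1 \<epsilon>) * norm u)"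
      using U by (intro add_mono mult_left_mono norm_diag_near_le e) auto
    also have "\<dots> = norm b + \<bar>\<theta>\<bar> * norm u + (\<epsilon> * norm b + ub 2 1 \<epsilon> * (\<bar>\<theta>\<bar> * norm u))"
      by (simp add: algebra_simps)
    \<comment> \<open>The bound \<open>T\<close> replaces \<theta> only inside terms already of
      order \<epsilon>; these become O(\<epsilon>^2) after multiplication by
      \<open>c\<^sub>s * \<epsilon>\<close>, while the leading term keeps the computed
      \<theta>.\<close>
    also have "\<dots> \<le> norm b + \<bar>\<theta>\<bar> * norm u + (\<epsilon> * norm b + 3 * \<epsilon> * (T * norm u))"
      using ub_le_linear[OF e0 e1, of 1 2] th_le e0 T(1)
      by (intro add_left_mono mult_mono) auto
    finally have "norm (d_hat R) \<le> norm b + \<bar>\<theta>\<bar> * norm u + (\<epsilon> * norm b + 3 * \<epsilon> * (T * norm u))" .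
    then have "c\<^sub>s * \<epsilon> * norm (d_hat R)
        \<le> c\<^sub>s * \<epsilon> * (norm b + \<bar>\<theta>\<bar> * norm u + (\<epsilon> * norm b + 3 * \<epsilon> * (T * norm u)))"
      by (rule mult_left_mono[OF _ ce])
    with g2 have g2': "norm g\<^sub>2
        \<le> c\<^sub>s * \<epsilon> * (norm b + \<bar>\<theta>\<bar> * norm u + (\<epsilon> * norm b + 3 * \<epsilon> * (T * norm u)))"
      by linarith
    have ub5: "0 \<le> ub 5 Khk \<epsilon>" "ub 5 Khk \<epsilon> \<le> (5 + Khk) * \<epsilon>"
      using nn(3) e0 e1 by (auto intro!: ub_nonneg ub_le_linear)
    have "norm (\<theta>\<^sub>1 *\<^sub>R (diag (\<lambda>i. h * k i) *v g\<^sub>1)) \<le> \<bar>\<theta>\<^sub>1\<bar> * ((1 + ub 5 Khk \<epsilon>) * norm g\<^sub>1)"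
      using norm_diag_near_le[of "\<lambda>i. h * k i" "ub 5 Khk \<epsilon>" g\<^sub>1] hk by (simp add: mult_left_mono)
    also have "\<dots> \<le> \<bar>\<theta>\<^sub>1\<bar> * ((1 + ub 5 Khk \<epsilon>) * (c\<^sub>s * \<epsilon> * norm u))"
      using g1 ub5 by (intro mult_left_mono) auto
    also have "\<dots> = c\<^sub>s * \<epsilon> * (\<bar>\<theta>\<^sub>1\<bar> * norm u + ub 5 Khk \<epsilon> * (\<bar>\<theta>\<^sub>1\<bar> * norm u))"
      by (simp add: algebra_simps)
    also have "\<dots> \<le> c\<^sub>s * \<epsilon> * (\<bar>\<theta>\<^sub>1\<bar> * norm u + (5 + Khk) * \<epsilon> * (T * norm u))"
      using ub5 th_le nn(3) e0 T(1) by (intro mult_left_mono[OF _ ce] add_left_mono mult_mono) auto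
    finally have "norm \<Delta>g \<le> c\<^sub>s * \<epsilon> * (norm b + \<bar>\<theta>\<bar> * norm u + (\<epsilon> * norm b + 3 * \<epsilon> * (T * norm u)))
        + c\<^sub>s * \<epsilon> * (\<bar>\<theta>\<^sub>1\<bar> * norm u + (5 + Khk) * \<epsilon> * (T * norm u))"
      unfolding \<Delta>g_def
      using g2' norm_triangle_ineq4[of g\<^sub>2 "\<theta>\<^sub>1 *\<^sub>R (diag (\<lambda>i. h * k i) *v g\<^sub>1)"] by linarith
    also have "\<dots> = c\<^sub>s * \<epsilon> * (norm b + norm u * (\<bar>\<theta>\<bar> + \<bar>\<theta>\<^sub>1\<bar>)) + Kg * \<epsilon>\<^sup>2"
      by (simp add: Kg_def power2_eq_square algebra_simps)
    also have "\<dots> \<le> c\<^sub>s * \<epsilon> * (norm b + norm u * (\<bar>\<theta>\<bar> + \<bar>\<theta>\<^sub>1\<bar>)) + C * \<epsilon>\<^sup>2"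
      by (intro add_left_mono mult_right_mono C) simp
    finally have 6: "norm \<Delta>g \<le> c\<^sub>s * \<epsilon> * (norm b + norm u * (\<bar>\<theta>\<bar> + \<bar>\<theta>\<^sub>1\<bar>)) + C * \<epsilon>\<^sup>2" .
    note eq = msm_perturbed_identity[OF z w d th zp wp, of A,
        folded U_def V_def \<Delta>A_def \<Delta>G\<^sub>1_def \<Delta>g_def]
    show "\<exists>(\<Delta>A :: real^'n^'n) (\<Delta>G :: real^'n^'n)
         (\<Delta>u :: real^'n) (\<Delta>v :: real^'n) (\<Delta>b :: real^'n) (\<Delta>g :: real^'n).
        (A + \<Delta>A + outer (u + \<Delta>u) (v + \<Delta>v)) *v x_hat R = b + \<Delta>b + \<Delta>G *v p_hat R + \<Delta>g \<and>
        mnorm2 \<Delta>A \<le> ((1 + c\<^sub>s) * \<epsilon> + C * \<epsilon>\<^sup>2) * mnorm2 A \<and>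
        norm \<Delta>u \<le> (2 * \<epsilon> + C * \<epsilon>\<^sup>2) * norm u \<and>
        norm \<Delta>v \<le> ((real CARD('n) + 1) * \<epsilon> + C * \<epsilon>\<^sup>2) * norm v \<and>
        norm \<Delta>b \<le> \<epsilon> * norm b \<and>
        mnorm2 \<Delta>G \<le> ((6 + 2 * c\<^sub>s) * \<epsilon> + C * \<epsilon>\<^sup>2) * mnorm2 A
                   + ((2 * real CARD('n) + 4) * \<epsilon> + C * \<epsilon>\<^sup>2) * (norm u * norm v) \<and>
        norm \<Delta>g \<le> c\<^sub>s * \<epsilon> * (norm b + norm u * (\<bar>theta_hat R\<bar> + \<bar>theta1_hat R\<bar>)) + C * \<epsilon>\<^sup>2"
      using eq 1 2 3 4 5 6
      unfolding ub_def n_def \<theta>_def \<theta>\<^sub>1_def add.commute[of c\<^sub>s 1] by blast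
  qed
qed

end
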